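(* Let $f:\mathcal{H}\to\mathbb{R}$ be nonnegative, convex and of class $C^1$. Then the eikonal equation $\|\nabla\psi\|^2=f$ on $\mathcal{H}$ has at most one bounded below solution $\psi\in C^2(\mathcal{H})$, up to an additive constant. In addition, this solution (if it exists) is convex.
   Context: $\mathcal{H}$ is a real Hilbert space with norm $\|\cdot\|$; $C^2(\mathcal{H})$ denotes the real-valued functions of class $C^2$ on $\mathcal{H}$, and $\nabla$ denotes the gradient. *)

theory Defs
  imports "HOL-Analysis.Analysis"
begin

text \<open>Classes \<open>C\<^sup>1\<close> and \<open>C\<^sup>2\<close> are understood in the Frechet sense: continuity of the
  derivatives is with respect to the operator norm, i.e. the norm of the type \<open>\<Rightarrow>\<^sub>L\<close>.\<close>

definition C1 :: "('a::real_normed_vector \<Rightarrow> 'b::real_normed_vector) \<Rightarrow> bool"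
  where "C1 f \<longleftrightarrow>
    (\<exists>D :: 'a \<Rightarrow> 'a \<Rightarrow>\<^sub>L 'b.
      (\<forall>x. (f has_derivative blinfun_apply (D x)) (at x)) \<and> continuous_on UNIV D)"

definition C2 :: "('a::real_normed_vector \<Rightarrow> 'b::real_normed_vector) \<Rightarrow> bool"
  where "C2 f \<longleftrightarrow>
    (\<exists>D :: 'a \<Rightarrow> 'a \<Rightarrow>\<^sub>L 'b.
      (\<forall>x. (f has_derivative blinfun_apply (D x)) (at x)) \<and> C1 D)"

text \<open>The gradient is unique whenever it exists, so the relational formulation below
  says that \<open>\<psi>\<close> has a gradient at every point and that its squared norm is \<open>f\<close>.\<close>

definition eikonal_solution :: "('a::real_inner \<Rightarrow> real) \<Rightarrow> ('a \<Rightarrow> real) \<Rightarrow> bool"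
  where "eikonal_solution f \<psi> \<longleftrightarrow>
    (\<forall>x. \<exists>g. GDERIV \<psi> x :> g \<and> (norm g)\<^sup>2 = f x)"

end

theory Submission
  imports Defs
begin

text \<open>Follow the gradient downhill.  Along a curve with \<open>x' = - \<nabla>\<psi>(x)\<close> the function \<open>\<psi>\<close> decreases
  at rate \<open>\<parallel>\<nabla>\<psi>\<parallel>\<^sup>2 = f\<close>, and since \<open>\<psi>\<close> is bounded below the curve has finite energy.  By the
  Cauchy-Schwarz inequality it moves by at most \<open>C \<surd>T\<close> during \<open>[0, T]\<close>
  (\<open>flow_displacement_bound\<close>).  In particular it cannot blow up, so it exists for all times
  (\<open>flow_exists\<close>).  Differentiating the eikonal equation gives \<open>D\<^sup>2\<psi> \<nabla>\<psi> = \<nabla>f / 2\<close>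
  (\<open>hessian_along_gradient\<close>), so \<open>x\<close> also solves Newton's equation \<open>x'' = \<nabla>f(x) / 2\<close>, from which
  \<open>\<psi>\<close> has disappeared.

  Now take two solutions \<open>\<psi>\<^sub>1, \<psi>\<^sub>2\<close>, equal or not, and two flow lines \<open>x, y\<close> of theirs with
  starting points \<open>a, b\<close>.  Convexity of \<open>f\<close> makes \<open>\<nabla>f\<close> monotone, so the difference \<open>u = x - y\<close>
  satisfies \<open>\<langle>u, u''\<rangle> \<ge> 0\<close>, which makes \<open>h = \<surd>(1 + \<parallel>u\<parallel>\<^sup>2)\<close> a convex function of time.  But \<open>h\<close>
  grows at most like \<open>\<surd>T\<close>, and a convex function with sublinear growth cannot have a positive
  initial slope.  Hence \<open>\<langle>a - b, \<nabla>\<psi>\<^sub>1(a) - \<nabla>\<psi>\<^sub>2(b)\<rangle> \<ge> 0\<close> for all \<open>a\<close> and \<open>b\<close>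
  (\<open>eikonal_gradients_monotone\<close>).

  For \<open>\<psi>\<^sub>1 = \<psi>\<^sub>2\<close> this says that the gradient is monotone, that is, the solution is convex.  For
  two solutions, letting \<open>b\<close> tend to \<open>a\<close> along a line (Minty's trick,
  \<open>gradients_eq_of_mixed_monotone\<close>) forces \<open>\<nabla>\<psi>\<^sub>1 = \<nabla>\<psi>\<^sub>2\<close>, so they differ by a constant.\<close>

section \<open>Flow lines of locally Lipschitz vector fields\<close>

definition flow_line :: "('a::real_normed_vector \<Rightarrow> 'a) \<Rightarrow> real \<Rightarrow> (real \<Rightarrow> 'a) \<Rightarrow> bool"
  where "flow_line V \<tau> x \<longleftrightarrow>
    (\<forall>t\<in>{0..\<tau>}. (x has_vector_derivative V (x t)) (at t within {0..\<tau>}))"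

lemma flow_line_continuous: "flow_line V \<tau> x \<Longrightarrow> continuous_on {0..\<tau>} x"
  by (auto simp: flow_line_def continuous_on_eq_continuous_within
      intro: has_vector_derivative_continuous)

lemma flow_line_at:
  assumes "flow_line V \<tau> x" "0 < t" "t < \<tau>"
  shows "(x has_vector_derivative V (x t)) (at t)"
  using assms at_within_Icc_at[of 0 t \<tau>] unfolding flow_line_def
  by (metis atLeastAtMost_iff less_imp_le)

lemma flow_line_restrict:
  "flow_line V \<tau> x \<Longrightarrow> \<sigma> \<le> \<tau> \<Longrightarrow> flow_line V \<sigma> x"
  unfolding flow_line_def
  by (metis atLeastAtMost_iff atLeastatMost_subset_iff has_vector_derivative_within_subset
      order_refl order_trans)

lemma flow_line_concat:
  fixes x y :: "real \<Rightarrow> 'a::real_normed_vector"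
  assumes x: "flow_line V \<sigma> x" and y: "flow_line V h y" and match: "y 0 = x \<sigma>"
    and "0 \<le> \<sigma>" "0 \<le> h"
  shows "flow_line V (\<sigma> + h) (\<lambda>t. if t \<in> {0..\<sigma>} then x t else y (t - \<sigma>))"
proof -
  have cl: "closure {0..\<sigma>} = {0..\<sigma>}" "closure {\<sigma>..\<sigma>+h} = {\<sigma>..\<sigma>+h}"
    "{0..\<sigma>} \<inter> {\<sigma>..\<sigma>+h} = {\<sigma>}" "{0..\<sigma>} \<union> {\<sigma>..\<sigma>+h} = {0..\<sigma>+h}"
    "{0..\<sigma>} \<union> {\<sigma>} = {0..\<sigma>}" "{\<sigma>..\<sigma>+h} \<union> {\<sigma>} = {\<sigma>..\<sigma>+h}"
    using assms by auto
  have y': "((\<lambda>t. y (t - \<sigma>)) has_vector_derivative V (y (t - \<sigma>))) (at t within {\<sigma>..\<sigma>+h})"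
    if "t \<in> {\<sigma>..\<sigma>+h}" for t
  proof -
    have "((\<lambda>t. t - \<sigma>) has_vector_derivative 1) (at t within {\<sigma>..\<sigma>+h})"
      by (auto intro!: derivative_eq_intros)
    moreover have "(y has_vector_derivative V (y (t - \<sigma>))) (at (t - \<sigma>) within (\<lambda>t. t - \<sigma>) ` {\<sigma>..\<sigma>+h})"
      using y that by (auto simp: flow_line_def)
    ultimately show ?thesis
      using vector_diff_chain_within[of "\<lambda>t. t - \<sigma>" 1 t _ y] by (simp add: o_def)
  qed
  show ?thesis
    unfolding flow_line_def
  proof
    fix t assume t: "t \<in> {0..\<sigma> + h}"
    have "((\<lambda>t. if t \<in> {0..\<sigma>} then x t else y (t - \<sigma>)) has_vector_derivative
        (if t \<in> {0..\<sigma>} then V (x t) else V (y (t - \<sigma>)))) (at t within {0..\<sigma>+h})"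
    proof (rule has_vector_derivative_If_within_closures[where T = "{\<sigma>..\<sigma>+h}"])
      show "t \<in> {0..\<sigma>} \<union> {\<sigma>..\<sigma>+h}" "{0..\<sigma>+h} = {0..\<sigma>} \<union> {\<sigma>..\<sigma>+h}"
        using t cl by auto
      show "(x has_vector_derivative V (x t))
            (at t within {0..\<sigma>} \<union> closure {0..\<sigma>} \<inter> closure {\<sigma>..\<sigma>+h})"
        if "t \<in> {0..\<sigma>} \<union> closure {0..\<sigma>} \<inter> closure {\<sigma>..\<sigma>+h}"
        using that x unfolding cl by (auto simp: flow_line_def)
      show "((\<lambda>t. y (t - \<sigma>)) has_vector_derivative V (y (t - \<sigma>)))
            (at t within {\<sigma>..\<sigma>+h} \<union> closure {0..\<sigma>} \<inter> closure {\<sigma>..\<sigma>+h})"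
        if "t \<in> {\<sigma>..\<sigma>+h} \<union> closure {0..\<sigma>} \<inter> closure {\<sigma>..\<sigma>+h}"
        using that y' unfolding cl by simp
      show "x t = y (t - \<sigma>)" "V (x t) = V (y (t - \<sigma>))"
        if "t \<in> closure {0..\<sigma>}" "t \<in> closure {\<sigma>..\<sigma>+h}"
        using that match unfolding cl by (auto simp: antisym)
    qed
    then show "((\<lambda>t. if t \<in> {0..\<sigma>} then x t else y (t - \<sigma>)) has_vector_derivative
        V (if t \<in> {0..\<sigma>} then x t else y (t - \<sigma>))) (at t within {0..\<sigma>+h})"
      by (simp add: if_distrib)
  qed
qed

lemma has_real_derivative_inner_self:
  fixes u :: "real \<Rightarrow> 'a::real_inner"
  assumes "(u has_vector_derivative w) (at t within S)"
  shows "((\<lambda>t. inner (u t) (u t)) has_real_derivative 2 * inner (u t) w) (at t within S)"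
proof -
  have "((\<lambda>t. inner (u t) (u t)) has_derivative
      (\<lambda>h. inner (u t) (h *\<^sub>R w) + inner (h *\<^sub>R w) (u t))) (at t within S)"
    using assms unfolding has_vector_derivative_def by (intro has_derivative_inner)
  then show ?thesis
    by (simp add: has_field_derivative_def inner_commute mult_commute_abs algebra_simps)
qed

text \<open>The two curves have a compact union, on which the field has a single Lipschitz constant
  \<open>L\<close>.  The squared distance \<open>\<parallel>x - y\<parallel>\<^sup>2\<close> then grows at most at the rate \<open>2 L\<close> relative to itself, so
  its product with \<open>exp (- 2 L t)\<close> is nonincreasing from the value \<open>0\<close>.\<close>

lemma flow_line_unique:
  fixes V :: "'a::real_inner \<Rightarrow> 'a"
  assumes lip: "local_lipschitz (UNIV::real set) UNIV (\<lambda>_. V)"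
    and x: "flow_line V \<tau> x" and y: "flow_line V \<tau> y" and "x 0 = y 0"
    and t: "t \<in> {0..\<tau>}"
  shows "x t = y t"
proof -
  define K where "K = x ` {0..\<tau>} \<union> y ` {0..\<tau>}"
  have "compact K"
    unfolding K_def by (intro compact_Un compact_continuous_image flow_line_continuous[OF x]
        flow_line_continuous[OF y] compact_Icc)
  moreover have "local_lipschitz {0::real} K (\<lambda>_. V)"
    using local_lipschitz_subset[OF lip] by blast
  ultimately obtain L where L: "L-lipschitz_on K V"
    using local_lipschitz_compact_implies_lipschitz[where X = K and T = "{0::real}" and f = "\<lambda>_. V"]
    by auto
  define q where "q s = inner (x s - y s) (x s - y s) * exp (- (2 * L * s))" for s
  have "q t \<le> q 0"
  proof (rule DERIV_nonpos_imp_decreasing_open[where f = q and a = 0 and b = t])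
    show "0 \<le> t" using t by simp
    have "continuous_on {0..t} x" "continuous_on {0..t} y"
      using t flow_line_continuous[OF flow_line_restrict] x y by auto
    then show "continuous_on {0..t} q"
      unfolding q_def by (intro continuous_intros)
    fix s assume s: "0 < s" "s < t"
    let ?u = "x s - y s" and ?w = "V (x s) - V (y s)"
    have "((\<lambda>s. x s - y s) has_vector_derivative ?w) (at s)"
      using t s by (intro derivative_intros flow_line_at[OF x] flow_line_at[OF y]) auto
    moreover have "((\<lambda>s. exp (- (2 * L * s))) has_real_derivative - (2 * L) * exp (- (2 * L * s))) (at s)"
      by (auto intro!: derivative_eq_intros)
    ultimately have "(q has_real_derivative
        (2 * inner ?u ?w - 2 * L * inner ?u ?u) * exp (- (2 * L * s))) (at s)"
      unfolding q_def
      by (rule DERIV_cong[OF DERIV_mult[OF has_real_derivative_inner_self]]) algebra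
    moreover have "inner ?u ?w \<le> L * inner ?u ?u"
    proof -
      have "inner ?u ?w \<le> norm ?u * norm ?w" by (rule norm_cauchy_schwarz)
      also have "\<dots> \<le> norm ?u * (L * norm ?u)"
        using lipschitz_on_normD[OF L, of "x s" "y s"] s t
        by (intro mult_left_mono) (auto simp: K_def)
      finally show ?thesis by (simp add: dot_square_norm power2_eq_square mult_ac)
    qed
    ultimately show "\<exists>d. (q has_real_derivative d) (at s) \<and> d \<le> 0"
      by (auto intro!: exI mult_nonpos_nonneg)
  qed
  then have "inner (x t - y t) (x t - y t) * exp (- (2 * L * t)) \<le> 0"
    using \<open>x 0 = y 0\<close> by (simp add: q_def)
  then have "inner (x t - y t) (x t - y t) \<le> 0"
    by (simp add: mult_le_0_iff not_le[symmetric])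
  then show ?thesis by (metis inner_ge_zero antisym inner_eq_zero_iff right_minus_eq)
qed

text \<open>Picard iteration on the space of bounded continuous curves in the ball \<open>cball l r\<close>.  The
  time \<open>h\<close> depends on the ball alone and not on the starting point \<open>z\<close> in the concentric ball of half
  the radius; this uniformity is what allows a flow line approaching \<open>l\<close> to be continued.\<close>

lemma flow_line_exists_locally:
  fixes V :: "'a::banach \<Rightarrow> 'a"
  assumes cont: "continuous_on UNIV V" and "0 < r" and lip: "L-lipschitz_on (cball l r) V"
  obtains h where "0 < h"
    "\<And>z. z \<in> cball l (r / 2) \<Longrightarrow> \<exists>x. x 0 = z \<and> flow_line V h x"
proof -
  have "0 \<le> L" using lip lipschitz_on_nonneg by blast
  define B where "B = norm (V l) + L * r"
  have B: "norm (V y) \<le> B" if "y \<in> cball l r" for y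
  proof -
    have "norm (V y - V l) \<le> L * norm (y - l)"
      using that \<open>0 < r\<close> by (intro lipschitz_on_normD[OF lip]) auto
    also have "\<dots> \<le> L * r"
      using that \<open>0 \<le> L\<close> by (intro mult_left_mono) (auto simp: dist_norm norm_minus_commute)
    finally show ?thesis
      unfolding B_def using norm_triangle_sub[of "V y" "V l"] by linarith
  qed
  have "0 \<le> B" using \<open>0 \<le> L\<close> \<open>0 < r\<close> by (simp add: B_def)
  \<comment> \<open>short enough for the curve to stay in the ball and for the Picard operator to be a
    contraction with factor \<open>1/2\<close>\<close>
  define h where "h = min (r / (2 * (B + 1))) (1 / (2 * (L + 1)))"
  have "0 < h" using \<open>0 \<le> L\<close> \<open>0 \<le> B\<close> \<open>0 < r\<close> by (simp add: h_def)
  have Bh: "B * h \<le> r / 2"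
  proof -
    have "B * h \<le> B * (r / (2 * (B + 1)))"
      using \<open>0 \<le> B\<close> by (intro mult_left_mono) (auto simp: h_def)
    also have "\<dots> \<le> r / 2" using \<open>0 \<le> B\<close> \<open>0 < r\<close> by (simp add: field_simps)
    finally show ?thesis .
  qed
  have Lh: "L * h \<le> 1 / 2"
  proof -
    have "L * h \<le> L * (1 / (2 * (L + 1)))"
      using \<open>0 \<le> L\<close> by (intro mult_left_mono) (auto simp: h_def)
    also have "\<dots> \<le> 1 / 2" using \<open>0 \<le> L\<close> by (simp add: field_simps)
    finally show ?thesis .
  qed
  \<comment> \<open>Bounded continuous functions are total, so curves on \<open>[0, h]\<close> are extended to be constant
    outside by clamping the time.\<close>
  define c where "c t = max 0 (min h t)" for t :: real
  have c: "c t \<in> {0..h}" "c t \<le> h" "0 \<le> c t" for t using \<open>0 < h\<close> by (auto simp: c_def)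
  have c_id: "c t = t" if "t \<in> {0..h}" for t using that by (auto simp: c_def)
  have c_cont: "continuous_on UNIV c" unfolding c_def by (intro continuous_intros)
  have "\<exists>x. x 0 = z \<and> flow_line V h x" if z: "z \<in> cball l (r / 2)" for z
  proof -
    define S :: "(real \<Rightarrow>\<^sub>C 'a) set" where "S = PiC UNIV (\<lambda>_. cball l r)"
    define P where "P \<phi> t = z + integral {0..c t} (\<lambda>s. V (\<phi> s))" for \<phi> :: "real \<Rightarrow> 'a" and t
    have Vc: "continuous_on A (\<lambda>s. V (apply_bcontfun \<phi> s))" for A and \<phi> :: "real \<Rightarrow>\<^sub>C 'a"
      by (rule continuous_on_compose2[OF cont]) auto
    have S: "apply_bcontfun \<phi> s \<in> cball l r" if "\<phi> \<in> S" for \<phi> s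
      using that unfolding S_def by (auto simp: mem_PiC_iff)
    have P_cont: "continuous_on UNIV (P (apply_bcontfun \<phi>))" for \<phi>
    proof -
      have "continuous_on {0..h} (\<lambda>t. integral {0..t} (\<lambda>s. V (apply_bcontfun \<phi> s)))"
        by (intro indefinite_integral_continuous_1 integrable_continuous_interval Vc)
      then have "continuous_on UNIV (\<lambda>t. integral {0..c t} (\<lambda>s. V (apply_bcontfun \<phi> s)))"
        by (rule continuous_on_compose2[OF _ c_cont]) (use c in auto)
      then show ?thesis unfolding P_def by (intro continuous_intros)
    qed
    have P_ball: "P (apply_bcontfun \<phi>) t \<in> cball l r" if "\<phi> \<in> S" for \<phi> t
    proof -
      have "norm (integral {0..c t} (\<lambda>s. V (apply_bcontfun \<phi> s))) \<le> B * (c t - 0)"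
        using c S[OF that] by (intro integral_bound Vc B) auto
      also have "\<dots> \<le> B * h" using c \<open>0 \<le> B\<close> by (intro mult_left_mono) auto
      finally have "norm (P (apply_bcontfun \<phi>) t - z) \<le> r / 2" using Bh by (simp add: P_def)
      moreover have "norm (z - l) \<le> r / 2" using z by (simp add: dist_norm norm_minus_commute)
      ultimately have "norm (P (apply_bcontfun \<phi>) t - l) \<le> r"
        using norm_triangle_ineq[of "P (apply_bcontfun \<phi>) t - z" "z - l"] by simp
      then show ?thesis by (simp add: dist_norm norm_minus_commute)
    qed
    have P_bcont: "P (apply_bcontfun \<phi>) \<in> bcontfun" if "\<phi> \<in> S" for \<phi>
    proof -
      have "range (P (apply_bcontfun \<phi>)) \<subseteq> cball l r" using P_ball[OF that] by blast
      then show ?thesis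
        using P_cont bounded_subset[OF bounded_cball] unfolding bcontfun_def by blast
    qed
    have PB: "apply_bcontfun (Bcontfun (P (apply_bcontfun \<phi>))) = P (apply_bcontfun \<phi>)"
      if "\<phi> \<in> S" for \<phi>
      using Bcontfun_inverse[OF P_bcont[OF that]] .
    have "\<exists>!\<phi>\<in>S. Bcontfun (P (apply_bcontfun \<phi>)) = \<phi>"
    proof (rule Banach_fix)
      show "complete S" unfolding S_def complete_eq_closed by (intro closed_PiC closed_cball)
      have "const_bcontfun l \<in> S"
        using \<open>0 < r\<close> by (auto simp: S_def mem_PiC_iff const_bcontfun.rep_eq)
      then show "S \<noteq> {}" by blast
      show "(\<lambda>\<phi>. Bcontfun (P (apply_bcontfun \<phi>))) ` S \<subseteq> S"
        using P_ball PB by (auto simp: S_def mem_PiC_iff simp del: mem_cball)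
      show "0 \<le> (1/2::real)" "(1/2::real) < 1" by simp_all
      fix \<phi> \<eta> assume \<phi>: "\<phi> \<in> S" and \<eta>: "\<eta> \<in> S"
      show "dist (Bcontfun (P (apply_bcontfun \<phi>))) (Bcontfun (P (apply_bcontfun \<eta>)))
          \<le> 1/2 * dist \<phi> \<eta>"
      proof (rule dist_bound)
        fix t
        have "P (apply_bcontfun \<phi>) t - P (apply_bcontfun \<eta>) t =
            integral {0..c t} (\<lambda>s. V (apply_bcontfun \<phi> s) - V (apply_bcontfun \<eta> s))"
          unfolding P_def
          by (subst Henstock_Kurzweil_Integration.integral_diff)
            (auto intro!: integrable_continuous_interval Vc)
        also have "norm \<dots> \<le> L * dist \<phi> \<eta> * (c t - 0)"
        proof (intro integral_bound continuous_intros Vc)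
          fix s
          have "norm (V (apply_bcontfun \<phi> s) - V (apply_bcontfun \<eta> s))
              \<le> L * norm (apply_bcontfun \<phi> s - apply_bcontfun \<eta> s)"
            using S[OF \<phi>] S[OF \<eta>] by (intro lipschitz_on_normD[OF lip])
          also have "\<dots> \<le> L * dist \<phi> \<eta>"
            using dist_bounded[of \<phi> s \<eta>] \<open>0 \<le> L\<close> by (intro mult_left_mono) (auto simp: dist_norm)
          finally show "norm (V (apply_bcontfun \<phi> s) - V (apply_bcontfun \<eta> s)) \<le> L * dist \<phi> \<eta>" .
        qed (use c in auto)
        also have "\<dots> \<le> L * dist \<phi> \<eta> * h"
          using c \<open>0 \<le> L\<close> by (intro mult_left_mono) auto
        also have "\<dots> = L * h * dist \<phi> \<eta>" by simp
        also have "\<dots> \<le> 1/2 * dist \<phi> \<eta>" using Lh by (intro mult_right_mono) auto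
        finally show "dist (apply_bcontfun (Bcontfun (P (apply_bcontfun \<phi>))) t)
            (apply_bcontfun (Bcontfun (P (apply_bcontfun \<eta>))) t) \<le> 1/2 * dist \<phi> \<eta>"
          using PB[OF \<phi>] PB[OF \<eta>] by (simp add: dist_norm)
      qed
    qed
    then obtain \<phi> where "\<phi> \<in> S" "Bcontfun (P (apply_bcontfun \<phi>)) = \<phi>" by blast
    then have fp: "P (apply_bcontfun \<phi>) t = apply_bcontfun \<phi> t" for t using PB by metis
    have "apply_bcontfun \<phi> 0 = z"
      using \<open>0 < h\<close> fp[of 0] by (simp add: P_def c_def)
    moreover have "flow_line V h (apply_bcontfun \<phi>)"
      unfolding flow_line_def
    proof
      fix t assume t: "t \<in> {0..h}"
      have "((\<lambda>t. z + integral {0..t} (\<lambda>s. V (apply_bcontfun \<phi> s))) has_vector_derivative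
          0 + V (apply_bcontfun \<phi> t)) (at t within {0..h})"
        by (intro has_vector_derivative_add has_vector_derivative_const
            integral_has_vector_derivative[OF Vc t])
      moreover have "apply_bcontfun \<phi> s = z + integral {0..s} (\<lambda>s. V (apply_bcontfun \<phi> s))"
        if "s \<in> {0..h}" for s
        using fp[of s] c_id[OF that] by (simp add: P_def)
      ultimately show "(apply_bcontfun \<phi> has_vector_derivative V (apply_bcontfun \<phi> t)) (at t within {0..h})"
        using has_vector_derivative_transform[OF t] by (metis (no_types, lifting) add_0)
    qed
    ultimately show ?thesis by blast
  qed
  then show thesis using that \<open>0 < h\<close> by blast
qed

text \<open>A flow line that satisfies an a priori Hoelder bound cannot escape in finite time, even in
  infinite dimension: if \<open>\<sigma>\<close> is the supremum of the existence times, the end points of flow lines on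
  \<open>[0, \<tau> n]\<close> with \<open>\<tau> n\<close> tending to \<open>\<sigma>\<close> form a Cauchy sequence by uniqueness and the bound, and near
  its limit there is a uniform existence time, which carries the flow beyond \<open>\<sigma>\<close>.\<close>

lemma flow_line_exists_globally:
  fixes V :: "'a::{real_inner, banach} \<Rightarrow> 'a"
  assumes lip: "local_lipschitz (UNIV::real set) UNIV (\<lambda>_. V)"
    and apriori: "\<And>\<tau> x s t. \<lbrakk>flow_line V \<tau> x; x 0 = z; 0 \<le> s; s \<le> t; t \<le> \<tau>\<rbrakk>
      \<Longrightarrow> (norm (x t - x s))\<^sup>2 \<le> M * (t - s)"
  shows "\<exists>x. x 0 = z \<and> flow_line V T x"
proof (rule ccontr)
  define S where "S = {\<tau>. 0 \<le> \<tau> \<and> (\<exists>x. x 0 = z \<and> flow_line V \<tau> x)}"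
  assume "\<nexists>x. x 0 = z \<and> flow_line V T x"
  then have bdd: "\<tau> < T" if "\<tau> \<in> S" for \<tau>
    using that flow_line_restrict[of V \<tau> _ T] unfolding S_def by (force simp: not_less[symmetric])
  have "0 \<in> S"
    by (auto simp: S_def flow_line_def has_vector_derivative_def
        has_derivative_within_singleton_iff bounded_linear_scaleR_left intro!: exI[of _ "\<lambda>_. z"])
  define \<sigma> where "\<sigma> = Sup S"
  have bS: "bdd_above S" using bdd by (meson bdd_above.I less_imp_le)
  have upper: "\<tau> \<le> \<sigma>" if "\<tau> \<in> S" for \<tau> unfolding \<sigma>_def by (rule cSup_upper[OF that bS])
  have "\<sigma> \<in> closure S" unfolding \<sigma>_def using \<open>0 \<in> S\<close> bS by (intro closure_contains_Sup) auto
  then obtain \<tau> where \<tau>: "\<And>n::nat. \<tau> n \<in> S" and lim: "\<tau> \<longlonglongrightarrow> \<sigma>"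
    by (auto simp: closure_sequential)
  obtain x where x: "\<And>n. x n 0 = z" "\<And>n. flow_line V (\<tau> n) (x n)"
    using \<tau> unfolding S_def by (simp) metis
  have \<tau>0: "0 \<le> \<tau> n" for n using \<tau> by (simp add: S_def)
  define e where "e n = x n (\<tau> n)" for n
  have est: "(norm (e m - e n))\<^sup>2 \<le> M * (\<tau> m - \<tau> n)" if "\<tau> n \<le> \<tau> m" for m n
  proof -
    have "x m (\<tau> n) = x n (\<tau> n)"
      using flow_line_unique[OF lip flow_line_restrict[OF x(2)[of m] that] x(2)[of n]] x(1) \<tau>0 by auto
    then show ?thesis
      using apriori[OF x(2)[of m] x(1) \<tau>0[of n] that] by (simp add: e_def)
  qed
  have est': "(norm (e m - e n))\<^sup>2 \<le> M * \<bar>\<tau> m - \<tau> n\<bar>" for m n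
    using est[of m n] est[of n m] by (cases "\<tau> n \<le> \<tau> m") (auto simp: norm_minus_commute)
  have "Cauchy e"
  proof (rule CauchyI)
    fix d :: real assume "0 < d"
    have "Cauchy \<tau>" using lim by (rule LIMSEQ_imp_Cauchy)
    then obtain N where N: "\<And>m n. m \<ge> N \<Longrightarrow> n \<ge> N \<Longrightarrow> \<bar>\<tau> m - \<tau> n\<bar> < d\<^sup>2 / (\<bar>M\<bar> + 1)"
      using CauchyD[of \<tau> "d\<^sup>2 / (\<bar>M\<bar> + 1)"] \<open>0 < d\<close> by auto
    have "norm (e m - e n) < d" if "m \<ge> N" "n \<ge> N" for m n
    proof -
      have "(norm (e m - e n))\<^sup>2 \<le> (\<bar>M\<bar> + 1) * \<bar>\<tau> m - \<tau> n\<bar>"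
        by (rule order_trans[OF est']) (intro mult_right_mono, auto)
      also have "\<dots> < d\<^sup>2" using N[OF that] by (simp add: field_simps)
      finally show ?thesis using \<open>0 < d\<close> by (simp add: power_less_imp_less_base)
    qed
    then show "\<exists>N. \<forall>m\<ge>N. \<forall>n\<ge>N. norm (e m - e n) < d" by blast
  qed
  then obtain l where l: "e \<longlonglongrightarrow> l" using Cauchy_convergent_iff convergent_def by blast
  obtain r L where r: "0 < r" "L-lipschitz_on (cball l r) V"
    using local_lipschitzE[OF lip UNIV_I[of 0] UNIV_I[of l]] by (metis Int_UNIV_right centre_in_cball less_imp_le)
  have contV: "continuous_on UNIV V" using local_lipschitz_continuous_on[OF lip] by blast
  obtain h where h: "0 < h" "\<And>z. z \<in> cball l (r / 2) \<Longrightarrow> \<exists>x. x 0 = z \<and> flow_line V h x"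
    using flow_line_exists_locally[OF contV r] by blast
  have "\<forall>\<^sub>F n in sequentially. dist (e n) l < r / 2"
    using tendstoD[OF l half_gt_zero[OF r(1)]] .
  moreover have "\<forall>\<^sub>F n in sequentially. dist (\<tau> n) \<sigma> < h" using tendstoD[OF lim h(1)] .
  ultimately have "\<forall>\<^sub>F n in sequentially. dist (e n) l < r / 2 \<and> dist (\<tau> n) \<sigma> < h"
    by (rule eventually_conj)
  then obtain n where n: "dist (e n) l < r / 2" "dist (\<tau> n) \<sigma> < h"
    using eventually_happens'[OF sequentially_bot] by blast
  obtain y where y: "y 0 = e n" "flow_line V h y"
    using h(2)[of "e n"] n(1) by (auto simp: dist_commute)
  define w where "w = (\<lambda>t. if t \<in> {0..\<tau> n} then x n t else y (t - \<tau> n))"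
  have "flow_line V (\<tau> n + h) w"
    unfolding w_def using flow_line_concat[OF x(2) y(2)] y(1) \<tau>0 h(1) by (auto simp: e_def)
  moreover have "w 0 = z" using \<tau>0 x(1) by (simp add: w_def)
  ultimately have "\<tau> n + h \<in> S" using \<tau>0[of n] h(1) unfolding S_def by auto
  then show False using upper[of "\<tau> n + h"] n(2) by (simp add: dist_real_def)
qed

section \<open>Second derivatives and convexity\<close>

text \<open>The second difference of \<open>f\<close> at \<open>x\<close> with steps \<open>s v\<close> and \<open>s w\<close> is symmetric in \<open>v\<close> and \<open>w\<close>, and
  equals \<open>s\<^sup>2 E z w v\<close> for some \<open>z\<close> whose distance to \<open>x\<close> is of order \<open>s\<close>; let \<open>s\<close> tend to \<open>0\<close>.\<close>

lemma second_derivative_symmetric: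
  fixes f :: "'a::real_normed_vector \<Rightarrow> real"
    and D :: "'a \<Rightarrow> 'a \<Rightarrow>\<^sub>L real" and E :: "'a \<Rightarrow> 'a \<Rightarrow>\<^sub>L 'a \<Rightarrow>\<^sub>L real"
  assumes D: "\<And>x. (f has_derivative blinfun_apply (D x)) (at x)"
    and E: "\<And>x. (D has_derivative blinfun_apply (E x)) (at x)"
    and cont: "continuous_on UNIV E"
  shows "E x v w = E x w v"
proof -
  \<comment> \<open>the mean value theorem in the direction \<open>v\<close>, then in the direction \<open>w\<close>\<close>
  have second_difference:
    "\<exists>z. norm (z - x) \<le> s * (norm v + norm w) \<and>
      f (x + s *\<^sub>R v + s *\<^sub>R w) - f (x + s *\<^sub>R v) - f (x + s *\<^sub>R w) + f x = s * s * E z w v"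
    if "0 < s" for s v w
  proof -
    define \<phi> where "\<phi> r = f (x + r *\<^sub>R v + s *\<^sub>R w) - f (x + r *\<^sub>R v)" for r
    have "(\<phi> has_derivative (\<lambda>h. D (x + r *\<^sub>R v + s *\<^sub>R w) (h *\<^sub>R v) - D (x + r *\<^sub>R v) (h *\<^sub>R v)))
        (at r within {0..s})" for r
      unfolding \<phi>_def
      by (rule has_derivative_diff; rule has_derivative_compose[OF _ D];
          auto intro!: derivative_eq_intros)
    from mvt_simple[OF \<open>0 < s\<close> this] obtain a where a: "0 < a" "a < s"
      "\<phi> s - \<phi> 0 = D (x + a *\<^sub>R v + s *\<^sub>R w) (s *\<^sub>R v) - D (x + a *\<^sub>R v) (s *\<^sub>R v)"
      by auto
    define \<eta> where "\<eta> r = D (x + a *\<^sub>R v + r *\<^sub>R w) v" for r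
    have "(\<eta> has_derivative (\<lambda>h. E (x + a *\<^sub>R v + r *\<^sub>R w) (h *\<^sub>R w) v)) (at r within {0..s})" for r
    proof -
      have "((\<lambda>r. D (x + a *\<^sub>R v + r *\<^sub>R w)) has_derivative
          (\<lambda>h. E (x + a *\<^sub>R v + r *\<^sub>R w) (h *\<^sub>R w))) (at r within {0..s})"
        by (rule has_derivative_compose[OF _ E]; auto intro!: derivative_eq_intros)
      from bounded_linear.has_derivative[OF blinfun.bounded_linear_left this]
      show ?thesis unfolding \<eta>_def .
    qed
    from mvt_simple[OF \<open>0 < s\<close> this] obtain b where b: "0 < b" "b < s"
      "\<eta> s - \<eta> 0 = E (x + a *\<^sub>R v + b *\<^sub>R w) (s *\<^sub>R w) v"
      by auto
    let ?z = "x + a *\<^sub>R v + b *\<^sub>R w"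
    have "\<phi> s - \<phi> 0 = s * (\<eta> s - \<eta> 0)"
      unfolding a(3) \<eta>_def by (simp add: blinfun.scaleR_right algebra_simps)
    then have "\<phi> s - \<phi> 0 = s * s * E ?z w v"
      unfolding b(3) by (simp add: blinfun.scaleR_right blinfun.scaleR_left)
    moreover have "norm (?z - x) \<le> s * (norm v + norm w)"
    proof -
      have "norm (?z - x) \<le> norm (a *\<^sub>R v) + norm (b *\<^sub>R w)"
        using norm_triangle_ineq[of "a *\<^sub>R v" "b *\<^sub>R w"] by (simp add: algebra_simps)
      also have "\<dots> \<le> s * norm v + s * norm w"
        using a b by (auto intro!: add_mono mult_right_mono)
      finally show ?thesis by (simp add: algebra_simps)
    qed
    ultimately show ?thesis by (intro exI[of _ ?z]) (simp add: \<phi>_def)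
  qed
  have "\<exists>z. norm (z - x) \<le> s * (norm v + norm w) \<and> (\<exists>y. norm (y - x) \<le> s * (norm v + norm w) \<and>
      E z w v = E y v w)" if "0 < s" for s
  proof -
    obtain z where z: "norm (z - x) \<le> s * (norm v + norm w)"
      "f (x + s *\<^sub>R v + s *\<^sub>R w) - f (x + s *\<^sub>R v) - f (x + s *\<^sub>R w) + f x = s * s * E z w v"
      using second_difference[OF \<open>0 < s\<close>, of v w] by blast
    obtain y where y: "norm (y - x) \<le> s * (norm w + norm v)"
      "f (x + s *\<^sub>R w + s *\<^sub>R v) - f (x + s *\<^sub>R w) - f (x + s *\<^sub>R v) + f x = s * s * E y v w"
      using second_difference[OF \<open>0 < s\<close>, of w v] by blast
    have "x + s *\<^sub>R w + s *\<^sub>R v = x + s *\<^sub>R v + s *\<^sub>R w" by simp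
    with y(2) have "f (x + s *\<^sub>R v + s *\<^sub>R w) - f (x + s *\<^sub>R w) - f (x + s *\<^sub>R v) + f x
        = s * s * E y v w"
      by simp
    with z(2) have "s * s * E z w v = s * s * E y v w" by linarith
    then show ?thesis using z(1) y(1) that by (auto simp: add.commute)
  qed
  then have "\<forall>n. \<exists>z y. norm (z - x) \<le> inverse (real (Suc n)) * (norm v + norm w) \<and>
      norm (y - x) \<le> inverse (real (Suc n)) * (norm v + norm w) \<and> E z w v = E y v w"
    by (metis inverse_positive_iff_positive of_nat_0_less_iff zero_less_Suc)
  then obtain z y where zy: "\<And>n. norm (z n - x) \<le> inverse (real (Suc n)) * (norm v + norm w)"
    "\<And>n. norm (y n - x) \<le> inverse (real (Suc n)) * (norm v + norm w)"
    "\<And>n. E (z n) w v = E (y n) v w"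
    by metis
  have lim0: "(\<lambda>n. inverse (real (Suc n)) * (norm v + norm w)) \<longlonglongrightarrow> 0"
    using tendsto_mult[OF LIMSEQ_inverse_real_of_nat tendsto_const] by fastforce
  have "z \<longlonglongrightarrow> x" "y \<longlonglongrightarrow> x"
    using zy(1,2) by (auto intro!: LIM_zero_cancel[OF Lim_null_comparison[OF _ lim0]])
  then have "(\<lambda>n. E (z n) w v) \<longlonglongrightarrow> E x w v" "(\<lambda>n. E (y n) v w) \<longlonglongrightarrow> E x v w"
    using cont by (auto intro!: tendsto_intros continuous_on_tendsto_compose[OF cont])
  then show ?thesis using zy(3) LIMSEQ_unique by simp
qed

lemma convex_on_derivative_below:
  fixes f :: "'a::real_normed_vector \<Rightarrow> real"
  assumes conv: "convex_on UNIV f" and F: "(f has_derivative F) (at x)"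
  shows "f x + F (y - x) \<le> f y"
proof -
  define k where "k s = f (x + s *\<^sub>R (y - x))" for s
  have "convex_on UNIV k"
  proof (rule convex_onI)
    fix t a b :: real assume t: "0 < t" "t < 1"
    have "x + ((1 - t) *\<^sub>R a + t *\<^sub>R b) *\<^sub>R (y - x) =
        (1 - t) *\<^sub>R (x + a *\<^sub>R (y - x)) + t *\<^sub>R (x + b *\<^sub>R (y - x))"
      by (simp add: algebra_simps)
    then show "k ((1 - t) *\<^sub>R a + t *\<^sub>R b) \<le> (1 - t) * k a + t * k b"
      unfolding k_def using convex_onD[OF conv, of t] t by simp
  qed simp
  moreover have "(k has_real_derivative F (y - x)) (at 0)"
  proof -
    have "(k has_derivative (\<lambda>h. F (h *\<^sub>R (y - x)))) (at 0)"
      unfolding k_def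
      by (rule has_derivative_compose[where g = f]) (use F in \<open>auto intro!: derivative_eq_intros\<close>)
    then show ?thesis
      using linear_cmul[OF has_derivative_linear[OF F]]
      by (simp add: has_field_derivative_def mult_commute_abs)
  qed
  ultimately have "k 1 - k 0 \<ge> F (y - x) * (1 - 0)"
    by (intro convex_on_imp_above_tangent[where A = UNIV]) auto
  then show ?thesis by (simp add: k_def)
qed

corollary convex_on_derivative_mono:
  fixes f :: "'a::real_normed_vector \<Rightarrow> real"
  assumes "convex_on UNIV f" "(f has_derivative F) (at x)" "(f has_derivative G) (at y)"
  shows "0 \<le> F (x - y) - G (x - y)"
proof -
  have "F (y - x) = - F (x - y)"
    using linear_neg[OF has_derivative_linear[OF assms(2)], of "x - y"] by simp
  then show ?thesis
    using convex_on_derivative_below[OF assms(1,2), of y]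
      convex_on_derivative_below[OF assms(1,3), of x] by linarith
qed

lemma convex_on_monotone_derivative:
  fixes f :: "'a::real_normed_vector \<Rightarrow> real"
  assumes F: "\<And>x. (f has_derivative F x) (at x)"
    and mono: "\<And>x y. 0 \<le> F x (x - y) - F y (x - y)"
  shows "convex_on UNIV f"
proof (rule convex_onI)
  fix t :: real and x y :: 'a assume t: "0 < t" "t < 1"
  define k where "k s = f (x + s *\<^sub>R (y - x))" for s
  have cmul: "F z (c *\<^sub>R v) = c * F z v" for z c v
    using linear_cmul[OF has_derivative_linear[OF F]] by simp
  have "convex_on UNIV k"
  proof (rule convex_on_realI)
    show "(k has_real_derivative F (x + s *\<^sub>R (y - x)) (y - x)) (at s)" for s
    proof -
      have "(k has_derivative (\<lambda>h. F (x + s *\<^sub>R (y - x)) (h *\<^sub>R (y - x)))) (at s)"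
        unfolding k_def
        by (rule has_derivative_compose[OF _ F]) (auto intro!: derivative_eq_intros)
      then show ?thesis by (simp add: has_field_derivative_def mult_commute_abs cmul)
    qed
    fix a b :: real assume "a \<le> b"
    show "F (x + a *\<^sub>R (y - x)) (y - x) \<le> F (x + b *\<^sub>R (y - x)) (y - x)"
    proof (cases "a = b")
      case False
      have "(x + b *\<^sub>R (y - x)) - (x + a *\<^sub>R (y - x)) = (b - a) *\<^sub>R (y - x)"
        by (simp add: algebra_simps)
      then have "0 \<le> (b - a) * (F (x + b *\<^sub>R (y - x)) (y - x) - F (x + a *\<^sub>R (y - x)) (y - x))"
        using mono[of "x + b *\<^sub>R (y - x)" "x + a *\<^sub>R (y - x)"] by (simp add: cmul right_diff_distrib)
      then show ?thesis using False \<open>a \<le> b\<close> by (simp add: zero_le_mult_iff)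
    qed simp
  qed simp
  from convex_onD[OF this, of t 0 1] show "f ((1 - t) *\<^sub>R x + t *\<^sub>R y) \<le> (1 - t) * f x + t * f y"
    using t by (simp add: k_def algebra_simps)
qed simp

section \<open>Gradient flow of a solution of the eikonal equation\<close>

text \<open>The gradient \<open>g\<close> and the differential \<open>D\<close> are kept side by side: the derivative of the field
  \<open>g\<close> would need the Riesz representation theorem, whereas \<open>D\<close> is differentiable by assumption and
  every derivative below can be taken after pairing with a vector.\<close>

locale eikonal_C2 =
  fixes f :: "'a::{real_inner, banach} \<Rightarrow> real" and F :: "'a \<Rightarrow> 'a \<Rightarrow> real"
    and \<psi> :: "'a \<Rightarrow> real" and g :: "'a \<Rightarrow> 'a"
    and D :: "'a \<Rightarrow> 'a \<Rightarrow>\<^sub>L real" and E :: "'a \<Rightarrow> 'a \<Rightarrow>\<^sub>L 'a \<Rightarrow>\<^sub>L real"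
    and m :: real
  assumes f_deriv: "\<And>x. (f has_derivative F x) (at x)"
    and psi_deriv: "\<And>x. (\<psi> has_derivative blinfun_apply (D x)) (at x)"
    and D_deriv: "\<And>x. (D has_derivative blinfun_apply (E x)) (at x)"
    and E_cont: "continuous_on UNIV E"
    and grad: "\<And>x v. D x v = inner v (g x)"
    and eikonal: "\<And>x. inner (g x) (g x) = f x"
    and lower: "\<And>x. m \<le> \<psi> x"
begin

text \<open>The distance between two gradients is at most that between the two differentials, and a
  differential with continuous derivative is Lipschitz near every point.\<close>

lemma gradient_local_lipschitz: "local_lipschitz (UNIV::real set) UNIV (\<lambda>_ x. - g x)"
proof -
  have norm_le: "norm (g x - g y) \<le> norm (D x - D y)" for x y
  proof (cases "g x = g y")
    case False
    have "norm (g x - g y) * norm (g x - g y) = (D x - D y) (g x - g y)"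
      by (simp add: blinfun.diff_left grad inner_diff_right[symmetric] dot_square_norm power2_eq_square)
    also have "\<dots> \<le> norm (D x - D y) * norm (g x - g y)"
      using norm_blinfun[of "D x - D y" "g x - g y"] by simp
    finally show ?thesis using False by simp
  qed simp
  show ?thesis
  proof (rule local_lipschitzI)
    fix x :: 'a
    have "isCont E x" using E_cont by (simp add: continuous_on_eq_continuous_at)
    then obtain r where r: "0 < r" "\<And>y. dist y x < r \<Longrightarrow> dist (E y) (E x) < 1"
      unfolding continuous_at_eps_delta by (metis dist_norm zero_less_one)
    define L where "L = norm (E x) + 1"
    have "L-lipschitz_on (cball x (r/2)) g"
    proof (rule lipschitz_onI)
      fix y z assume yz: "y \<in> cball x (r/2)" "z \<in> cball x (r/2)"
      have "norm (D y - D z) \<le> L * norm (y - z)"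
      proof (rule differentiable_bound[OF convex_cball _ _ yz])
        show "(D has_derivative blinfun_apply (E u)) (at u within cball x (r/2))" for u
          using D_deriv by (rule has_derivative_at_withinI)
        fix u assume "u \<in> cball x (r/2)"
        then have "dist (E u) (E x) < 1" using r by (intro r(2)) (auto simp: dist_commute)
        then show "onorm (blinfun_apply (E u)) \<le> L"
          unfolding L_def norm_blinfun.rep_eq[symmetric] dist_norm
          using norm_triangle_sub[of "E u" "E x"] by linarith
      qed
      then show "dist (g y) (g z) \<le> L * dist y z" using norm_le[of y z] by (simp add: dist_norm)
    qed (simp add: L_def)
    then show "\<exists>u>0. \<exists>L. \<forall>t\<in>cball t u \<inter> UNIV. L-lipschitz_on (cball x u \<inter> UNIV) (\<lambda>x. - g x)"
      for t :: real
      using r(1) by (intro exI[of _ "r/2"]) auto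
  qed
qed

text \<open>This is the derivative of the eikonal equation.  It is obtained from the function
  \<open>y \<mapsto> \<parallel>g y - g x\<parallel>\<^sup>2\<close>, which the eikonal equation expresses through \<open>f\<close> and \<open>D\<close> and which has a
  minimum at \<open>x\<close>, where its derivative must vanish.\<close>

lemma hessian_along_gradient: "E x v (g x) = F x v / 2"
proof -
  define k where "k y = f y - 2 * D y (g x) + f x" for y
  have k: "k y = inner (g y - g x) (g y - g x)" for y
    by (simp add: k_def grad eikonal[symmetric] inner_diff inner_commute)
  have "((\<lambda>y. D y (g x)) has_derivative (\<lambda>v. E x v (g x))) (at x)"
    using bounded_linear.has_derivative[OF blinfun.bounded_linear_left D_deriv] .
  then have "(k has_derivative (\<lambda>v. F x v - 2 * E x v (g x) + 0)) (at x)"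
    unfolding k_def
    by (intro has_derivative_add has_derivative_diff has_derivative_mult_right has_derivative_const f_deriv)
  then have "(\<lambda>v. F x v - 2 * E x v (g x) + 0) = (\<lambda>v. 0)"
    by (rule differential_zero_maxmin[of x UNIV, rotated 2]) (auto simp: k)
  then have "F x v - 2 * E x v (g x) + 0 = 0" by (rule fun_cong)
  then show ?thesis by simp
qed

text \<open>In integral form this is the Cauchy-Schwarz inequality, as
  \<open>\<psi> (x s) - \<psi> (x t)\<close> is the integral of \<open>\<parallel>x'\<parallel>\<^sup>2\<close>.  Integrals are avoided: with \<open>v = x t - x s\<close> and
  \<open>\<delta> = t - s\<close>, the pointwise inequality \<open>- \<langle>g, v\<rangle> \<le> \<delta> \<parallel>g\<parallel>\<^sup>2 / 2 + \<parallel>v\<parallel>\<^sup>2 / (2 \<delta>)\<close> says that the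
  function \<open>q\<close> of the proof is nonincreasing.\<close>

lemma flow_displacement:
  assumes x: "flow_line (\<lambda>x. - g x) \<tau> x" and st: "0 \<le> s" "s \<le> t" "t \<le> \<tau>"
  shows "(norm (x t - x s))\<^sup>2 \<le> (\<psi> (x s) - \<psi> (x t)) * (t - s)"
proof (cases "s = t")
  case False
  define v where "v = x t - x s"
  define \<delta> where "\<delta> = t - s"
  have "0 < \<delta>" using st False by (simp add: \<delta>_def)
  define q where "q r = inner (x r) v + \<delta> / 2 * \<psi> (x r) - r * (inner v v / (2 * \<delta>))" for r
  have xc: "continuous_on {s..t} x"
    using st by (intro continuous_on_subset[OF flow_line_continuous[OF x]]) simp
  have \<psi>c: "continuous_on UNIV \<psi>"
    using has_derivative_continuous[OF psi_deriv] by (simp add: continuous_on_eq_continuous_at)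
  have "q t \<le> q s"
  proof (rule DERIV_nonpos_imp_decreasing_open[where f = q and a = s and b = t])
    show "s \<le> t" by fact
    show "continuous_on {s..t} q"
      unfolding q_def by (intro continuous_intros xc continuous_on_compose2[OF \<psi>c xc]) auto
    fix r assume r: "s < r" "r < t"
    have dx: "(x has_derivative (\<lambda>h. h *\<^sub>R (- g (x r)))) (at r)"
      using flow_line_at[OF x, of r] r st by (simp add: has_vector_derivative_def)
    have d\<psi>: "((\<lambda>r. \<psi> (x r)) has_real_derivative - inner (g (x r)) (g (x r))) (at r)"
      unfolding has_field_derivative_def
      by (rule has_derivative_eq_rhs[OF has_derivative_compose[OF dx psi_deriv]])
        (simp add: fun_eq_iff grad)
    have di: "((\<lambda>r. inner (x r) v) has_real_derivative - inner (g (x r)) v) (at r)"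
      unfolding has_field_derivative_def
      by (rule has_derivative_eq_rhs[OF has_derivative_inner_left[OF dx]]) (simp add: fun_eq_iff)
    have "(q has_real_derivative
        - inner (g (x r)) v + \<delta> / 2 * (- inner (g (x r)) (g (x r))) - inner v v / (2 * \<delta>)) (at r)"
      unfolding q_def using d\<psi> di \<open>0 < \<delta>\<close> by (auto intro!: derivative_eq_intros)
    moreover have "- inner (g (x r)) v + \<delta> / 2 * (- inner (g (x r)) (g (x r))) - inner v v / (2 * \<delta>)
        = - inner (\<delta> *\<^sub>R g (x r) + v) (\<delta> *\<^sub>R g (x r) + v) / (2 * \<delta>)"
      using \<open>0 < \<delta>\<close> by (simp add: field_simps inner_add inner_commute)
    ultimately show "\<exists>d. (q has_real_derivative d) (at r) \<and> d \<le> 0"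
      using \<open>0 < \<delta>\<close> by (auto intro!: exI divide_nonpos_pos)
  qed
  moreover have "inner (x t) v - inner (x s) v = inner v v" by (simp add: v_def inner_diff_left)
  moreover have "t * K - s * K = (t - s) * K" for K :: real by (simp add: left_diff_distrib)
  ultimately have "inner v v \<le> \<delta> / 2 * (\<psi> (x s) - \<psi> (x t)) + (t - s) * (inner v v / (2 * \<delta>))"
    unfolding q_def right_diff_distrib by (smt (verit))
  also have "(t - s) * (inner v v / (2 * \<delta>)) = inner v v / 2"
    using \<open>0 < \<delta>\<close> unfolding \<delta>_def[symmetric] by simp
  finally show ?thesis by (simp add: v_def \<delta>_def power2_norm_eq_inner mult.commute)
qed simp

lemma potential_antimono:
  assumes x: "flow_line (\<lambda>x. - g x) \<tau> x" and st: "0 \<le> s" "s \<le> t" "t \<le> \<tau>"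
  shows "\<psi> (x t) \<le> \<psi> (x s)"
proof (cases "s = t")
  case False
  have "0 \<le> (\<psi> (x s) - \<psi> (x t)) * (t - s)"
    using order_trans[OF zero_le_power2 flow_displacement[OF assms]] .
  then show ?thesis using False st by (simp add: zero_le_mult_iff)
qed simp

lemma flow_displacement_bound:
  assumes x: "flow_line (\<lambda>x. - g x) \<tau> x" and st: "0 \<le> s" "s \<le> t" "t \<le> \<tau>"
  shows "(norm (x t - x s))\<^sup>2 \<le> (\<psi> (x 0) - m) * (t - s)"
proof -
  have "\<psi> (x s) - \<psi> (x t) \<le> \<psi> (x 0) - m"
    using potential_antimono[OF x order_refl, of s] lower[of "x t"] st by simp
  then have "(\<psi> (x s) - \<psi> (x t)) * (t - s) \<le> (\<psi> (x 0) - m) * (t - s)"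
    using st by (intro mult_right_mono) auto
  then show ?thesis using flow_displacement[OF assms] by simp
qed

lemma flow_exists: "\<exists>x. x 0 = z \<and> flow_line (\<lambda>x. - g x) T x"
proof (rule flow_line_exists_globally[OF gradient_local_lipschitz, where M = "\<psi> z - m"])
  fix \<tau> x s t
  assume "flow_line (\<lambda>x. - g x) \<tau> x" "x 0 = z" "0 \<le> s" "s \<le> t" "t \<le> \<tau>"
  then show "(norm (x t - x s))\<^sup>2 \<le> (\<psi> z - m) * (t - s)"
    using flow_displacement_bound[of \<tau> x s t] by simp
qed

text \<open>Newton's equation \<open>x'' = \<nabla>f(x) / 2\<close> in weak form: as \<open>D (x t) (u t)\<close> is \<open>- \<langle>x', u\<rangle>\<close>, the term
  \<open>- F (x t) (u t) / 2\<close> is \<open>- \<langle>x'', u\<rangle>\<close>.  Symmetry of the second derivative moves the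
  velocity \<open>- g (x t)\<close> into the slot where \<open>hessian_along_gradient\<close> evaluates it.\<close>

lemma acceleration:
  assumes "(x has_vector_derivative - g (x t)) (at t within S)"
    and "(u has_vector_derivative u') (at t within S)"
  shows "((\<lambda>t. D (x t) (u t)) has_real_derivative D (x t) u' - F (x t) (u t) / 2) (at t within S)"
proof -
  have "((\<lambda>t. D (x t)) has_derivative (\<lambda>h. E (x t) (h *\<^sub>R (- g (x t))))) (at t within S)"
    using assms(1) unfolding has_vector_derivative_def by (rule has_derivative_compose[OF _ D_deriv])
  from blinfun.FDERIV[OF this assms(2)[unfolded has_vector_derivative_def]]
  have "((\<lambda>t. D (x t) (u t)) has_derivative
      (\<lambda>h. D (x t) (h *\<^sub>R u') + E (x t) (h *\<^sub>R (- g (x t))) (u t))) (at t within S)" .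
  then have *: "((\<lambda>t. D (x t) (u t)) has_derivative
      (\<lambda>h. h * (D (x t) u' - E (x t) (g (x t)) (u t)))) (at t within S)"
    by (rule has_derivative_eq_rhs) (simp add: fun_eq_iff blinfun.scaleR_right blinfun.scaleR_left
        blinfun.minus_right blinfun.minus_left right_diff_distrib)
  have "E (x t) (g (x t)) (u t) = F (x t) (u t) / 2"
    using second_derivative_symmetric[OF psi_deriv D_deriv E_cont, of "x t" "g (x t)" "u t"]
      hessian_along_gradient[of "x t" "u t"] by simp
  with * show ?thesis by (simp add: has_field_derivative_def mult_commute_abs)
qed

end

section \<open>Comparison of two solutions\<close>

text \<open>The number \<open>\<kappa>\<close> is the initial slope of \<open>h = \<surd>(1 + \<parallel>x - y\<parallel>\<^sup>2)\<close> for flow lines \<open>x, y\<close>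
  starting at \<open>a\<close> and \<open>b\<close>.  It does not depend on the length \<open>T\<close> of the time interval, so convexity
  of \<open>h\<close> and its growth of order \<open>\<surd>T\<close> give \<open>\<kappa> \<le> 0\<close> by letting \<open>T\<close> tend to infinity.  The
  summand \<open>1\<close> keeps \<open>h\<close> differentiable where the two curves meet.\<close>

lemma eikonal_gradients_monotone:
  assumes "eikonal_C2 f F \<psi>\<^sub>1 g\<^sub>1 D\<^sub>1 E\<^sub>1 m\<^sub>1" and "eikonal_C2 f F \<psi>\<^sub>2 g\<^sub>2 D\<^sub>2 E\<^sub>2 m\<^sub>2"
    and convex: "convex_on UNIV f"
  shows "0 \<le> inner (a - b) (g\<^sub>1 a - g\<^sub>2 b)"
proof -
  interpret A: eikonal_C2 f F \<psi>\<^sub>1 g\<^sub>1 D\<^sub>1 E\<^sub>1 m\<^sub>1 by fact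
  interpret B: eikonal_C2 f F \<psi>\<^sub>2 g\<^sub>2 D\<^sub>2 E\<^sub>2 m\<^sub>2 by fact
  define \<kappa> where "\<kappa> = - inner (a - b) (g\<^sub>1 a - g\<^sub>2 b) / sqrt (1 + inner (a - b) (a - b))"
  define C where "C = sqrt (\<psi>\<^sub>1 a - m\<^sub>1) + sqrt (\<psi>\<^sub>2 b - m\<^sub>2)"
  have bound: "\<kappa> * T \<le> norm (a - b) + C * sqrt T" if "0 < T" for T
  proof -
    obtain x where x: "x 0 = a" "flow_line (\<lambda>x. - g\<^sub>1 x) T x" using A.flow_exists by blast
    obtain y where y: "y 0 = b" "flow_line (\<lambda>x. - g\<^sub>2 x) T y" using B.flow_exists by blast
    define u where "u t = x t - y t" for t
    \<comment> \<open>\<open>w\<close> is the derivative of \<open>u\<close>\<close>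
    define w where "w t = g\<^sub>2 (y t) - g\<^sub>1 (x t)" for t
    define h where "h t = sqrt (1 + inner (u t) (u t))" for t
    define p where "p t = D\<^sub>2 (y t) (u t) - D\<^sub>1 (x t) (u t)" for t
    have p: "p t = inner (u t) (w t)" for t
      by (simp add: p_def w_def A.grad B.grad inner_diff_right)
    have h1: "1 \<le> h t" for t by (simp add: h_def)
    have hh: "h t * h t = 1 + inner (u t) (u t)" for t by (simp add: h_def)
    have du: "(u has_vector_derivative w t) (at t within {0..T})" if "t \<in> {0..T}" for t
    proof -
      have "(u has_vector_derivative (- g\<^sub>1 (x t) - - g\<^sub>2 (y t))) (at t within {0..T})"
        unfolding u_def using x(2) y(2) that
        by (intro has_vector_derivative_diff) (auto simp: flow_line_def)
      then show ?thesis by (simp add: w_def)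
    qed
    have dh: "(h has_real_derivative p t / h t) (at t within {0..T})" if "t \<in> {0..T}" for t
    proof -
      have pos: "0 < 1 + inner (u t) (u t)" by (simp add: add_pos_nonneg)
      have "((\<lambda>t. 1 + inner (u t) (u t)) has_real_derivative 2 * inner (u t) (w t)) (at t within {0..T})"
        using DERIV_add[OF DERIV_const has_real_derivative_inner_self[OF du[OF that]]] by simp
      from DERIV_chain2[OF DERIV_real_sqrt[OF pos] this]
      show ?thesis unfolding h_def p by (simp add: field_simps)
    qed
    have dp: "(p has_real_derivative inner (w t) (w t) + (F (x t) (u t) - F (y t) (u t)) / 2)
        (at t within {0..T})" if "t \<in> {0..T}" for t
    proof -
      have "(p has_real_derivative
          (D\<^sub>2 (y t) (w t) - F (y t) (u t) / 2) - (D\<^sub>1 (x t) (w t) - F (x t) (u t) / 2))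
          (at t within {0..T})"
        unfolding p_def using x(2) y(2) that
        by (intro DERIV_diff A.acceleration B.acceleration du) (auto simp: flow_line_def)
      moreover have "D\<^sub>2 (y t) (w t) - D\<^sub>1 (x t) (w t) = inner (w t) (w t)"
        unfolding A.grad B.grad by (simp add: w_def inner_diff_right)
      ultimately show ?thesis by (simp add: algebra_simps diff_divide_distrib)
    qed
    have slope_mono: "p 0 / h 0 \<le> p \<xi> / h \<xi>" if \<xi>: "0 < \<xi>" "\<xi> < T" for \<xi>
    proof -
      define d where "d t = ((inner (w t) (w t) + (F (x t) (u t) - F (y t) (u t)) / 2) * h t
          - p t * (p t / h t)) / (h t * h t)" for t
      have "((\<lambda>t. p t / h t) has_real_derivative d t) (at t within {0..\<xi>})"
        if "0 \<le> t" "t \<le> \<xi>" for t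
      proof -
        have "t \<in> {0..T}" "h t \<noteq> 0" using that \<xi> h1[of t] by auto
        from DERIV_divide[OF dp[OF this(1)] dh[OF this(1)] this(2)]
        have "((\<lambda>t. p t / h t) has_real_derivative d t) (at t within {0..T})"
          unfolding d_def .
        then show ?thesis by (rule DERIV_subset) (use \<xi> in auto)
      qed
      from mvt_simple[OF \<xi>(1) this[unfolded has_field_derivative_def]]
      obtain t where t: "p \<xi> / h \<xi> - p 0 / h 0 = d t * (\<xi> - 0)"
        by blast
      \<comment> \<open>\<open>h'' \<ge> 0\<close>: the term \<open>p\<^sup>2 / h\<close> is absorbed by \<open>h \<parallel>u'\<parallel>\<^sup>2\<close>, and the contribution of the
        accelerations is nonnegative because \<open>f\<close> is convex\<close>
      have "p t * p t \<le> inner (u t) (u t) * inner (w t) (w t)"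
        using Cauchy_Schwarz_ineq[of "u t" "w t"] by (simp add: p power2_eq_square)
      also have "\<dots> \<le> (h t * h t) * inner (w t) (w t)"
        unfolding hh by (intro mult_right_mono) auto
      finally have "p t * p t / h t \<le> h t * inner (w t) (w t)"
        using h1[of t] by (simp add: field_simps)
      moreover have "0 \<le> F (x t) (u t) - F (y t) (u t)"
        unfolding u_def by (rule convex_on_derivative_mono[OF convex A.f_deriv A.f_deriv])
      then have "0 \<le> (F (x t) (u t) - F (y t) (u t)) / 2 * h t" using h1[of t] by simp
      moreover have "d t = ((h t * inner (w t) (w t) - p t * p t / h t)
          + (F (x t) (u t) - F (y t) (u t)) / 2 * h t) / (h t * h t)"
        unfolding d_def by (simp add: distrib_right distrib_left mult.commute)
      ultimately have "0 \<le> d t" using h1[of t] by simp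
      then have "0 \<le> d t * (\<xi> - 0)" using \<xi> by (intro mult_nonneg_nonneg) auto
      then show ?thesis unfolding t[symmetric] by simp
    qed
    have "(h has_real_derivative p t / h t) (at t within {0..T})" if "0 \<le> t" "t \<le> T" for t
      using dh[of t] that by auto
    from mvt_simple[OF \<open>0 < T\<close> this[unfolded has_field_derivative_def]]
    obtain \<xi> where \<xi>: "0 < \<xi>" "\<xi> < T" "h T - h 0 = p \<xi> / h \<xi> * (T - 0)"
      by auto
    have "\<kappa> = p 0 / h 0"
      by (simp add: \<kappa>_def p h_def u_def w_def x(1) y(1) inner_diff_right)
    then have "\<kappa> * T \<le> p \<xi> / h \<xi> * T"
      using slope_mono[OF \<xi>(1,2)] \<open>0 < T\<close> by (intro mult_right_mono) auto
    also have "\<dots> = h T - h 0" using \<xi>(3) by simp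
    also have "\<dots> \<le> norm (u T)"
    proof -
      have "h T \<le> 1 + norm (u T)"
        unfolding h_def by (rule real_le_lsqrt) (auto simp: power2_sum power2_norm_eq_inner)
      then show ?thesis using h1[of 0] by simp
    qed
    also have "\<dots> \<le> norm (a - b) + (norm (x T - x 0) + norm (y T - y 0))"
    proof -
      have "u T = (a - b) + ((x T - x 0) - (y T - y 0))" by (simp add: u_def x(1) y(1))
      then show ?thesis
        using norm_triangle_ineq[of "a - b" "(x T - x 0) - (y T - y 0)"]
          norm_triangle_ineq4[of "x T - x 0" "y T - y 0"] by simp
    qed
    also have "\<dots> \<le> norm (a - b) + (sqrt (\<psi>\<^sub>1 a - m\<^sub>1) * sqrt T + sqrt (\<psi>\<^sub>2 b - m\<^sub>2) * sqrt T)"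
    proof (intro add_left_mono add_mono)
      show "norm (x T - x 0) \<le> sqrt (\<psi>\<^sub>1 a - m\<^sub>1) * sqrt T"
        using A.flow_displacement_bound[OF x(2), of 0 T] \<open>0 < T\<close> x(1)
        by (simp add: real_le_rsqrt flip: real_sqrt_mult)
      show "norm (y T - y 0) \<le> sqrt (\<psi>\<^sub>2 b - m\<^sub>2) * sqrt T"
        using B.flow_displacement_bound[OF y(2), of 0 T] \<open>0 < T\<close> y(1)
        by (simp add: real_le_rsqrt flip: real_sqrt_mult)
    qed
    finally show ?thesis by (simp add: C_def algebra_simps)
  qed
  have "\<kappa> \<le> 0"
  proof (rule tendsto_lowerbound)
    have "((\<lambda>T. norm (a - b) / T + C / sqrt T) \<longlongrightarrow> 0 + 0) at_top"
      by (intro tendsto_add tendsto_divide_0[OF tendsto_const] filterlim_at_top_imp_at_infinity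
          filterlim_ident sqrt_at_top)
    then show "((\<lambda>T. norm (a - b) / T + C / sqrt T) \<longlongrightarrow> 0) at_top" by simp
    show "\<forall>\<^sub>F T in at_top. \<kappa> \<le> norm (a - b) / T + C / sqrt T"
      using eventually_gt_at_top[of 0]
    proof eventually_elim
      case (elim T)
      have "C * sqrt T = (C / sqrt T) * T" using elim by (simp add: field_simps)
      then have "\<kappa> * T \<le> (norm (a - b) / T + C / sqrt T) * T"
        using bound[OF elim] elim by (simp add: distrib_right)
      then show ?case using elim by (simp only: mult_le_cancel_right_pos)
    qed
  qed simp
  moreover have "0 < sqrt (1 + inner (a - b) (a - b))" by (simp add: add_pos_nonneg)
  ultimately show ?thesis unfolding \<kappa>_def by (auto simp: zero_le_divide_iff)
qed

text \<open>Minty's trick: test with \<open>b = a + s v\<close> where \<open>v = g\<^sub>1 a - g\<^sub>2 a\<close>, divide by \<open>s > 0\<close> and let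
  \<open>s\<close> tend to \<open>0\<close>; this leaves \<open>\<parallel>v\<parallel>\<^sup>2 \<le> 0\<close>.\<close>

lemma gradients_eq_of_mixed_monotone:
  fixes g\<^sub>1 g\<^sub>2 :: "'a::real_inner \<Rightarrow> 'a"
  assumes mono: "\<And>a b. 0 \<le> inner (a - b) (g\<^sub>1 a - g\<^sub>2 b)"
    and cont: "isCont g\<^sub>2 a"
  shows "g\<^sub>1 a = g\<^sub>2 a"
proof -
  define v where "v = g\<^sub>1 a - g\<^sub>2 a"
  have "0 \<le> - inner v v"
  proof (rule tendsto_lowerbound)
    have "((\<lambda>s::real. a + s *\<^sub>R v) \<longlongrightarrow> a + 0 *\<^sub>R v) (at_right 0)"
      by (intro tendsto_intros)
    then have "((\<lambda>s::real. g\<^sub>2 (a + s *\<^sub>R v)) \<longlongrightarrow> g\<^sub>2 a) (at_right 0)"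
      using isCont_tendsto_compose[OF cont] by simp
    then show "((\<lambda>s::real. - inner v (g\<^sub>1 a - g\<^sub>2 (a + s *\<^sub>R v))) \<longlongrightarrow> - inner v v) (at_right 0)"
      unfolding v_def by (intro tendsto_intros)
    show "\<forall>\<^sub>F s in at_right 0. 0 \<le> - inner v (g\<^sub>1 a - g\<^sub>2 (a + s *\<^sub>R v))"
      unfolding eventually_at_right_field
    proof (intro exI[of _ 1] conjI allI impI)
      fix s :: real assume "0 < s"
      have "0 \<le> s * (- inner v (g\<^sub>1 a - g\<^sub>2 (a + s *\<^sub>R v)))"
        using mono[of a "a + s *\<^sub>R v"] by simp
      then show "0 \<le> - inner v (g\<^sub>1 a - g\<^sub>2 (a + s *\<^sub>R v))"
        using \<open>0 < s\<close> by (simp add: zero_le_mult_iff mult_le_0_iff)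
    qed simp
  qed simp
  then show ?thesis unfolding v_def by (metis inner_eq_zero_iff inner_ge_zero neg_0_le_iff_le order_antisym right_minus_eq)
qed

lemma eikonal_C2_of_solution:
  fixes f \<psi> :: "'a::{real_inner, banach} \<Rightarrow> real"
  assumes F: "\<And>x. (f has_derivative F x) (at x)"
    and "C2 \<psi>" "bdd_below (range \<psi>)" "eikonal_solution f \<psi>"
  obtains g D E m where "eikonal_C2 f F \<psi> g D E m"
proof -
  obtain D :: "'a \<Rightarrow> 'a \<Rightarrow>\<^sub>L real" and E where
    D: "\<And>x. (\<psi> has_derivative blinfun_apply (D x)) (at x)" and
    E: "\<And>x. (D has_derivative blinfun_apply (E x)) (at x)" "continuous_on UNIV E"
    using \<open>C2 \<psi>\<close> unfolding C2_def C1_def by blast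
  obtain g where g: "\<And>x. GDERIV \<psi> x :> g x" "\<And>x. (norm (g x))\<^sup>2 = f x"
    using \<open>eikonal_solution f \<psi>\<close> unfolding eikonal_solution_def by metis
  have "D x v = inner v (g x)" for x v
    using has_derivative_unique[OF D g(1)[unfolded gderiv_def]] by (rule fun_cong)
  moreover obtain m where "\<And>x. m \<le> \<psi> x"
    using \<open>bdd_below (range \<psi>)\<close> by (auto simp: bdd_below_def)
  ultimately have "eikonal_C2 f F \<psi> g D E m"
    using F D E g(2) by (unfold_locales) (auto simp: power2_norm_eq_inner)
  then show thesis by (rule that)
qed

theorem corollary3p21:
  fixes f :: "'a::{real_inner, banach} \<Rightarrow> real"
  assumes "\<forall>x. 0 \<le> f x"
    and "convex_on UNIV f"
    and "C1 f"
  shows "(\<forall>\<psi>\<^sub>1 \<psi>\<^sub>2 :: 'a \<Rightarrow> real.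
            C2 \<psi>\<^sub>1 \<and> bdd_below (range \<psi>\<^sub>1) \<and> eikonal_solution f \<psi>\<^sub>1 \<and>
            C2 \<psi>\<^sub>2 \<and> bdd_below (range \<psi>\<^sub>2) \<and> eikonal_solution f \<psi>\<^sub>2 \<longrightarrow>
            (\<exists>c. \<forall>x. \<psi>\<^sub>1 x = \<psi>\<^sub>2 x + c)) \<and>
         (\<forall>\<psi> :: 'a \<Rightarrow> real.
            C2 \<psi> \<and> bdd_below (range \<psi>) \<and> eikonal_solution f \<psi> \<longrightarrow> convex_on UNIV \<psi>)"
proof (intro conjI allI impI)
  obtain G :: "'a \<Rightarrow> 'a \<Rightarrow>\<^sub>L real" where F: "\<And>x. (f has_derivative G x) (at x)"
    using \<open>C1 f\<close> unfolding C1_def by blast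
  define F where "F x = blinfun_apply (G x)" for x
  have F: "\<And>x. (f has_derivative F x) (at x)"
    using F by (simp add: F_def)
  show "\<exists>c. \<forall>x. \<psi>\<^sub>1 x = \<psi>\<^sub>2 x + c"
    if sol: "C2 \<psi>\<^sub>1 \<and> bdd_below (range \<psi>\<^sub>1) \<and> eikonal_solution f \<psi>\<^sub>1 \<and>
      C2 \<psi>\<^sub>2 \<and> bdd_below (range \<psi>\<^sub>2) \<and> eikonal_solution f \<psi>\<^sub>2" for \<psi>\<^sub>1 \<psi>\<^sub>2
  proof -
    obtain g\<^sub>1 D\<^sub>1 E\<^sub>1 m\<^sub>1 where 1: "eikonal_C2 f F \<psi>\<^sub>1 g\<^sub>1 D\<^sub>1 E\<^sub>1 m\<^sub>1"
      using eikonal_C2_of_solution[OF F] sol by metis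
    obtain g\<^sub>2 D\<^sub>2 E\<^sub>2 m\<^sub>2 where 2: "eikonal_C2 f F \<psi>\<^sub>2 g\<^sub>2 D\<^sub>2 E\<^sub>2 m\<^sub>2"
      using eikonal_C2_of_solution[OF F] sol by metis
    interpret A: eikonal_C2 f F \<psi>\<^sub>1 g\<^sub>1 D\<^sub>1 E\<^sub>1 m\<^sub>1 by fact
    interpret B: eikonal_C2 f F \<psi>\<^sub>2 g\<^sub>2 D\<^sub>2 E\<^sub>2 m\<^sub>2 by fact
    have "isCont g\<^sub>2 x" for x
      using continuous_on_minus[OF local_lipschitz_continuous_on[OF B.gradient_local_lipschitz UNIV_I]]
      by (simp add: continuous_on_eq_continuous_at)
    then have "g\<^sub>1 x = g\<^sub>2 x" for x
      using gradients_eq_of_mixed_monotone eikonal_gradients_monotone[OF 1 2 \<open>convex_on UNIV f\<close>]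
      by blast
    then have "((\<lambda>x. \<psi>\<^sub>1 x - \<psi>\<^sub>2 x) has_derivative (\<lambda>v. 0)) (at x)" for x
      by (intro has_derivative_eq_rhs[OF has_derivative_diff[OF A.psi_deriv B.psi_deriv]])
        (simp add: A.grad B.grad)
    then obtain c where "\<And>x. \<psi>\<^sub>1 x - \<psi>\<^sub>2 x = c"
      using has_derivative_zero_constant[of UNIV "\<lambda>x. \<psi>\<^sub>1 x - \<psi>\<^sub>2 x"] by auto
    then have "\<forall>x. \<psi>\<^sub>1 x = \<psi>\<^sub>2 x + c" by (simp add: diff_eq_eq add.commute)
    then show ?thesis by blast
  qed
  show "convex_on UNIV \<psi>" if sol: "C2 \<psi> \<and> bdd_below (range \<psi>) \<and> eikonal_solution f \<psi>" for \<psi>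
  proof -
    obtain g D E m where e: "eikonal_C2 f F \<psi> g D E m"
      using eikonal_C2_of_solution[OF F] sol by metis
    interpret eikonal_C2 f F \<psi> g D E m by fact
    show ?thesis
      using convex_on_monotone_derivative[OF psi_deriv]
        eikonal_gradients_monotone[OF e e \<open>convex_on UNIV f\<close>]
      by (simp add: grad inner_diff_right)
  qed
qed

end
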